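(* Let $|\psi\rangle\in\mathbb{C}^2\otimes\mathbb{C}^2\otimes\mathbb{C}^2$ be a truly tripartite entangled (normalized) pure state of qubits $1,2,3$. Then there exist real numbers $a\ge b\ge 0$ with $a^2+b^2=1$, angles $\alpha,\gamma\in(-\pi/2,\pi/2]$ and $\beta,\beta'\in[0,\pi/2]$ such that, with $|\psi_s\rangle=a|00\rangle+b|11\rangle$, $U_2=Z(\alpha)Y(\beta)Z(\gamma)$ and $U_3=Y(\beta')$, the state $|\psi\rangle$ is LU-equivalent to $$\frac{1}{\sqrt2}\Big(|0\rangle_1\otimes|\psi_s\rangle_{23}+|1\rangle_1\otimes (U_2\otimes U_3)|\psi_s\rangle_{23}\Big),$$ and such that $\mathfrak{E}(C_{23})\le E(\psi_s)\le \mathfrak{E}(C_{23}^a)$.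
   Context: A pure three-qubit state is truly tripartite entangled if it is not a product state with respect to any of the bipartitions $1|23$, $2|13$, $3|12$. Two three-qubit states $|\psi\rangle,|\chi\rangle$ are LU-equivalent if $|\chi\rangle=(V_1\otimes V_2\otimes V_3)|\psi\rangle$ for some unitaries $V_i\in U(2)$. $\sigma_x,\sigma_y,\sigma_z$ are the Pauli matrices, $Y(\xi)=e^{i\xi\sigma_y}$, $Z(\xi)=e^{i\xi\sigma_z}$. For a bipartite pure state, $E$ denotes the von Neumann entropy (base-2 logarithm) of a one-party reduced state. The concurrence of a two-qubit pure state is $C(\phi)=|\langle\tilde\phi|\phi\rangle|$ with $|\tilde\phi\rangle=\sigma_y\otimes\sigma_y|\phi^*\rangle$ ($^*$ is complex conjugation in the computational basis). One has $E(\phi)=\mathfrak{E}(C(\phi))$, with the strictly increasing function $\mathfrak{E}(C)=h\big(\tfrac{1+\sqrt{1-C^2}}2\big)$, $h(x)=-x\log_2x-(1-x)\log_2(1-x)$, on $[0,1]$. For $\rho_{23}$, the reduced state of $|\psi\rangle$ on qubits $2,3$, set $C_{23}=\min\sum_j\pi_jC(\phi_j)$ (concurrence) and $C_{23}^a=\max\sum_j\pi_jC(\phi_j)$ (concurrence of assistance), the min and max being over all pure-state ensembles with $\rho_{23}=\sum_j\pi_j|\phi_j\rangle\langle\phi_j|$. *)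

theory Defs
  imports "HOL-Analysis.Analysis" "HOL-Computational_Algebra.Polynomial"
begin

(* State vectors are indexed by the computational basis: the type 2 has the two elements
   0 and 1 (with 2 = 0), so |0>, |1> live in complex^2 and the bases of two and three qubits
   are indexed by pairs and triples. *)

type_synonym qubit = "complex^2"
type_synonym qubits2 = "complex^(2 \<times> 2)"
type_synonym qubits3 = "complex^(2 \<times> 2 \<times> 2)"

definition ket0 :: qubit where "ket0 = axis 0 1"

definition ket1 :: qubit where "ket1 = axis 1 1"

definition tensor_vec :: "complex^'m \<Rightarrow> complex^'n \<Rightarrow> complex^('m \<times> 'n)"  (infixr "\<otimes>\<^sub>v" 75)
  where "u \<otimes>\<^sub>v v = (\<chi> p. u $ fst p * v $ snd p)"

definition tensor_mat ::
  "complex^'m^'m \<Rightarrow> complex^'n^'n \<Rightarrow> complex^('m \<times> 'n)^('m \<times> 'n)"  (infixr "\<otimes>\<^sub>m" 75)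
  where "A \<otimes>\<^sub>m B = (\<chi> p q. A $ fst p $ fst q * B $ snd p $ snd q)"

definition cnj_vec :: "complex^'n \<Rightarrow> complex^'n"
  where "cnj_vec v = (\<chi> i. cnj (v $ i))"

(* The Hermitian inner product, antilinear in the first argument; the library's inner is
   its real part. *)
definition braket :: "complex^'n \<Rightarrow> complex^'n \<Rightarrow> complex"
  where "braket u v = (\<Sum>i\<in>UNIV. cnj (u $ i) * v $ i)"

(* |v><v| *)
definition projector :: "complex^'n \<Rightarrow> complex^'n^'n"
  where "projector v = (\<chi> i j. v $ i * cnj (v $ j))"

definition adjoint_mat :: "complex^'n^'m \<Rightarrow> complex^'m^'n"
  where "adjoint_mat A = (\<chi> i j. cnj (A $ j $ i))"

definition unitary_mat :: "complex^'n^'n \<Rightarrow> bool"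
  where "unitary_mat U \<longleftrightarrow> adjoint_mat U ** U = mat 1 \<and> U ** adjoint_mat U = mat 1"

definition mat_scale :: "complex \<Rightarrow> complex^'n^'m \<Rightarrow> complex^'n^'m"
  where "mat_scale c A = map_matrix ((*) c) A"

(* The library's exp and (^) are not usable here: multiplication on vectors is componentwise. *)
primrec mat_pow :: "complex^'n^'n \<Rightarrow> nat \<Rightarrow> complex^'n^'n" where
  "mat_pow A 0 = mat 1"
| "mat_pow A (Suc k) = A ** mat_pow A k"

definition mat_exp :: "complex^'n^'n \<Rightarrow> complex^'n^'n"
  where "mat_exp A = (\<Sum>k. (1 / fact k) *\<^sub>R mat_pow A k)"

definition mat2 :: "complex \<Rightarrow> complex \<Rightarrow> complex \<Rightarrow> complex \<Rightarrow> complex^2^2"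
  where "mat2 a b c d =
    (\<chi> i j. if i = 0 then (if j = 0 then a else b) else (if j = 0 then c else d))"

definition sigma_y :: "complex^2^2" where "sigma_y = mat2 0 (- \<i>) \<i> 0"

definition sigma_z :: "complex^2^2" where "sigma_z = mat2 1 0 0 (- 1)"

definition Yrot :: "real \<Rightarrow> complex^2^2"
  where "Yrot \<xi> = mat_exp (mat_scale (\<i> * of_real \<xi>) sigma_y)"

definition Zrot :: "real \<Rightarrow> complex^2^2"
  where "Zrot \<xi> = mat_exp (mat_scale (\<i> * of_real \<xi>) sigma_z)"

(* The three disjuncts are the bipartitions 1|23, 2|13 and 3|12. *)
definition biseparable :: "qubits3 \<Rightarrow> bool"
  where "biseparable \<psi> \<longleftrightarrow>
    (\<exists>(u::qubit) (v::qubits2). \<forall>i j k. \<psi> $ (i, j, k) = u $ i * v $ (j, k)) \<or>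
    (\<exists>(u::qubit) (v::qubits2). \<forall>i j k. \<psi> $ (i, j, k) = u $ j * v $ (i, k)) \<or>
    (\<exists>(u::qubit) (v::qubits2). \<forall>i j k. \<psi> $ (i, j, k) = u $ k * v $ (i, j))"

definition truly_tripartite_entangled :: "qubits3 \<Rightarrow> bool"
  where "truly_tripartite_entangled \<psi> \<longleftrightarrow> \<not> biseparable \<psi>"

definition LU_equivalent :: "qubits3 \<Rightarrow> qubits3 \<Rightarrow> bool"
  where "LU_equivalent \<psi> \<psi>' \<longleftrightarrow>
    (\<exists>V1 V2 V3. unitary_mat V1 \<and> unitary_mat V2 \<and> unitary_mat V3 \<and>
      \<psi>' = (V1 \<otimes>\<^sub>m V2 \<otimes>\<^sub>m V3) *v \<psi>)"

(* Partial traces over the first and over the second tensor factor. *)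
definition trace_fst :: "complex^('m::finite \<times> 'n::finite)^('m \<times> 'n) \<Rightarrow> complex^'n^'n"
  where "trace_fst \<rho> = (\<chi> j j'. \<Sum>i\<in>UNIV. \<rho> $ (i, j) $ (i, j'))"

definition trace_snd :: "complex^('m::finite \<times> 'n::finite)^('m \<times> 'n) \<Rightarrow> complex^'m^'m"
  where "trace_snd \<rho> = (\<chi> i i'. \<Sum>j\<in>UNIV. \<rho> $ (i, j) $ (i', j))"

definition charpoly :: "complex^'n^'n \<Rightarrow> complex poly"
  where "charpoly A = det (\<chi> i j. (if i = j then [:0, 1:] else 0) - [:A $ i $ j:])"

(* - tr (rho log2 rho): the sum runs over the eigenvalues of rho, weighted with their
   multiplicities.  They are real for a density matrix, and 0 log2 0 = 0. *)
definition vn_entropy :: "complex^'n^'n \<Rightarrow> real"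
  where "vn_entropy \<rho> =
    - (\<Sum>x | poly (charpoly \<rho>) x = 0. real (order x (charpoly \<rho>)) * (Re x * log 2 (Re x)))"

definition entanglement :: "complex^('m::finite \<times> 'n::finite) \<Rightarrow> real"
  where "entanglement \<phi> = vn_entropy (trace_snd (projector \<phi>))"

definition spin_flip :: "qubits2 \<Rightarrow> qubits2"
  where "spin_flip \<phi> = (sigma_y \<otimes>\<^sub>m sigma_y) *v cnj_vec \<phi>"

definition concurrence :: "qubits2 \<Rightarrow> real"
  where "concurrence \<phi> = cmod (braket (spin_flip \<phi>) \<phi>)"

definition binary_entropy :: "real \<Rightarrow> real"
  where "binary_entropy x = - x * log 2 x - (1 - x) * log 2 (1 - x)"

definition ent_of_conc :: "real \<Rightarrow> real"
  where "ent_of_conc C = binary_entropy ((1 + sqrt (1 - C\<^sup>2)) / 2)"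

definition pure_ensemble ::
  "complex^'n^'n \<Rightarrow> nat \<Rightarrow> (nat \<Rightarrow> real) \<Rightarrow> (nat \<Rightarrow> complex^'n) \<Rightarrow> bool"
  where "pure_ensemble \<rho> n \<pi> \<phi> \<longleftrightarrow>
    (\<forall>j<n. 0 \<le> \<pi> j \<and> norm (\<phi> j) = 1) \<and> (\<Sum>j<n. \<pi> j) = 1 \<and>
    \<rho> = (\<Sum>j<n. \<pi> j *\<^sub>R projector (\<phi> j))"

definition ensemble_concurrences :: "complex^(2 \<times> 2)^(2 \<times> 2) \<Rightarrow> real set"
  where "ensemble_concurrences \<rho> =
    {\<Sum>j<n. \<pi> j * concurrence (\<phi> j) | n \<pi> \<phi>. pure_ensemble \<rho> n \<pi> \<phi>}"

(* The minimum and the maximum are attained for every density matrix rho: the pairs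
   (projector phi, concurrence phi), phi a unit vector, form a compact set, so its convex
   hull is compact as well. *)
definition mixed_concurrence :: "complex^(2 \<times> 2)^(2 \<times> 2) \<Rightarrow> real"
  where "mixed_concurrence \<rho> = (LEAST c. c \<in> ensemble_concurrences \<rho>)"

definition concurrence_of_assistance :: "complex^(2 \<times> 2)^(2 \<times> 2) \<Rightarrow> real"
  where "concurrence_of_assistance \<rho> = (GREATEST c. c \<in> ensemble_concurrences \<rho>)"

definition reduced23 :: "qubits3 \<Rightarrow> complex^(2 \<times> 2)^(2 \<times> 2)"
  where "reduced23 \<psi> = trace_fst (projector \<psi>)"

definition schmidt_state :: "real \<Rightarrow> real \<Rightarrow> qubits2"
  where "schmidt_state a b = of_real a *s (ket0 \<otimes>\<^sub>v ket0) + of_real b *s (ket1 \<otimes>\<^sub>v ket1)"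

end

theory Submission
  imports Defs
begin

text \<open>Write \<open>|\<psi>\<rangle> = |0\<rangle>|A\<rangle> + |1\<rangle>|B\<rangle>\<close>. A unitary on qubit 1 makes \<open>A\<close> and \<open>B\<close> orthogonal, and then
  \<open>A + e\<^bsup>it\<^esup> B\<close> and \<open>A - e\<^bsup>it\<^esup> B\<close> have equal norms for all \<open>t\<close>; since \<open>t \<mapsto> t + \<pi>\<close> exchanges them, the
  intermediate value theorem gives a \<open>t\<close> for which their concurrences agree as well. For two qubits
  norm and concurrence determine the Schmidt coefficients, so both components are local unitary
  images of the same \<open>|\<psi>\<^sub>s\<rangle>\<close>. The ranges of the angles come from Euler decompositions, two of whose
  diagonal factors are absorbed by the symmetry of \<open>|\<psi>\<^sub>s\<rangle>\<close>. The two components form an ensemble for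
  \<open>\<rho>\<^sub>2\<^sub>3\<close> of average concurrence \<open>C(\<psi>\<^sub>s)\<close>, so \<open>C(\<psi>\<^sub>s)\<close> lies between the minimum and the maximum, and
  the entropy is an increasing function of the concurrence.\<close>

section \<open>Tensor products and unitary matrices\<close>

text \<open>\<open>exhaust_2\<close> lists the elements as 1 and 2; since \<open>2 = 0\<close> in
  this type, the basis labels 0 and 1 exhaust it.\<close>

lemma UNIV_qubit: "(UNIV :: 2 set) = {0, 1}"
proof -
  have "(2::2) = 0" by simp
  then have "x \<in> {0, 1}" for x :: 2 using exhaust_2[of x] by auto
  then show ?thesis by blast
qed

lemma all_qubit: "(\<forall>i::2. P i) \<longleftrightarrow> P 0 \<and> P 1"
proof -
  have "(\<forall>i::2. P i) \<longleftrightarrow> (\<forall>i\<in>UNIV. P i)" by simp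
  then show ?thesis unfolding UNIV_qubit by simp
qed

lemma sum_qubit: "(\<Sum>i\<in>(UNIV :: 2 set). f i) = f 0 + f 1"
  by (simp add: UNIV_qubit)

lemma sum_pairs: "(\<Sum>p\<in>(UNIV :: ('m::finite \<times> 'n::finite) set). f p) = (\<Sum>i\<in>UNIV. \<Sum>j\<in>UNIV. f (i, j))"
  by (simp add: sum.cartesian_product flip: UNIV_Times_UNIV)

lemma mat2_nth [simp]:
  "mat2 a b c d $ 0 $ 0 = a" "mat2 a b c d $ 0 $ 1 = b"
  "mat2 a b c d $ 1 $ 0 = c" "mat2 a b c d $ 1 $ 1 = d"
  by (simp_all add: mat2_def)

lemma ket_nth [simp]: "ket0 $ 0 = 1" "ket0 $ 1 = 0" "ket1 $ 0 = 0" "ket1 $ 1 = 1"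
  by (simp_all add: ket0_def ket1_def axis_def)

lemma mat2_eta: "mat2 (A $ 0 $ 0) (A $ 0 $ 1) (A $ 1 $ 0) (A $ 1 $ 1) = A"
  by (simp add: vec_eq_iff all_qubit)

lemma mat2_mult: "mat2 a b c d ** mat2 a' b' c' d' =
    mat2 (a * a' + b * c') (a * b' + b * d') (c * a' + d * c') (c * b' + d * d')"
  by (simp add: vec_eq_iff all_qubit matrix_matrix_mult_def sum_qubit)

lemma mat2_one: "mat 1 = mat2 1 0 0 1"
  by (simp add: vec_eq_iff all_qubit mat_def)

lemma adjoint_mat2: "adjoint_mat (mat2 a b c d) = mat2 (cnj a) (cnj c) (cnj b) (cnj d)"
  by (simp add: vec_eq_iff all_qubit adjoint_mat_def)

lemma mat2_eq_iff: "mat2 a b c d = mat2 a' b' c' d' \<longleftrightarrow> a = a' \<and> b = b' \<and> c = c' \<and> d = d'"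
  by (simp add: vec_eq_iff all_qubit)

lemma tensor_vec_nth [simp]: "(u \<otimes>\<^sub>v v) $ (i, j) = u $ i * v $ j"
  by (simp add: tensor_vec_def)

lemma tensor_mat_nth [simp]: "(A \<otimes>\<^sub>m B) $ (i, j) $ (k, l) = A $ i $ k * B $ j $ l"
  by (simp add: tensor_mat_def)

lemma tensor_mat_mult: "(A \<otimes>\<^sub>m B) ** (C \<otimes>\<^sub>m D) = (A ** C) \<otimes>\<^sub>m (B ** D)"
  by (simp add: vec_eq_iff matrix_matrix_mult_def sum_pairs sum_product algebra_simps)

lemma tensor_mat_one: "mat 1 \<otimes>\<^sub>m mat 1 = mat 1"
  by (simp add: vec_eq_iff mat_def)

lemma adjoint_tensor_mat: "adjoint_mat (A \<otimes>\<^sub>m B) = adjoint_mat A \<otimes>\<^sub>m adjoint_mat B"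
  by (simp add: vec_eq_iff adjoint_mat_def)

lemma adjoint_mult: "adjoint_mat (A ** B) = adjoint_mat B ** adjoint_mat A"
  by (simp add: vec_eq_iff adjoint_mat_def matrix_matrix_mult_def mult.commute)

lemma adjoint_adjoint [simp]: "adjoint_mat (adjoint_mat A) = A"
  by (simp add: vec_eq_iff adjoint_mat_def)

lemma unitary_one: "unitary_mat (mat 1)"
proof -
  have "adjoint_mat (mat 1 :: complex^'n^'n) = mat 1"
    by (simp add: vec_eq_iff adjoint_mat_def mat_def)
  then show ?thesis by (simp add: unitary_mat_def)
qed

lemma unitary_adjoint: "unitary_mat A \<Longrightarrow> unitary_mat (adjoint_mat A)"
  by (simp add: unitary_mat_def)

lemma unitary_mult:
  assumes "unitary_mat A" "unitary_mat B"
  shows "unitary_mat (A ** B)"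
proof -
  have "adjoint_mat B ** adjoint_mat A ** (A ** B) = adjoint_mat B ** (adjoint_mat A ** A) ** B"
    "A ** B ** (adjoint_mat B ** adjoint_mat A) = A ** (B ** adjoint_mat B) ** adjoint_mat A"
    by (simp_all add: matrix_mul_assoc)
  then show ?thesis
    using assms by (simp add: unitary_mat_def adjoint_mult)
qed

lemma unitary_tensor: "unitary_mat A \<Longrightarrow> unitary_mat B \<Longrightarrow> unitary_mat (A \<otimes>\<^sub>m B)"
  by (simp add: unitary_mat_def adjoint_tensor_mat tensor_mat_mult tensor_mat_one)

text \<open>Orthonormal rows give a right inverse, and for a square matrix a one-sided inverse is
  two-sided.\<close>

lemma unitary_mat2:
  assumes "a * cnj a + b * cnj b = 1" "c * cnj c + d * cnj d = 1" "a * cnj c + b * cnj d = 0"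
  shows "unitary_mat (mat2 a b c d)"
proof -
  let ?A = "mat2 a b c d"
  have "c * cnj a + d * cnj b = 0"
    using arg_cong[OF assms(3), of cnj] by (simp add: mult.commute)
  then have "?A ** adjoint_mat ?A = mat 1"
    using assms by (simp add: adjoint_mat2 mat2_mult mat2_one mat2_eq_iff)
  then show ?thesis
    by (simp add: unitary_mat_def matrix_left_right_inverse)
qed

section \<open>Hermitian inner product, norm and the splitting by the first qubit\<close>

lemma braket_adjoint: "braket (A *v u) v = braket u (adjoint_mat A *v v)"
proof -
  have "braket (A *v u) v = (\<Sum>i\<in>UNIV. \<Sum>j\<in>UNIV. cnj (u $ j) * (cnj (A $ i $ j) * v $ i))"
    by (simp add: braket_def matrix_vector_mult_def sum_distrib_right sum_distrib_left mult_ac)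
  also have "\<dots> = braket u (adjoint_mat A *v v)"
    by (subst sum.swap) (simp add: braket_def matrix_vector_mult_def adjoint_mat_def sum_distrib_left)
  finally show ?thesis .
qed

lemma braket_self: "braket v v = of_real ((norm v)\<^sup>2)"
proof -
  have "(norm v)\<^sup>2 = (\<Sum>i\<in>UNIV. (cmod (v $ i))\<^sup>2)"
    by (simp add: norm_vec_def L2_set_def sum_nonneg)
  then show ?thesis
    by (simp add: braket_def complex_norm_square mult.commute del: of_real_power)
qed

lemma norm_unitary:
  assumes "unitary_mat U"
  shows "norm (U *v x) = norm x"
proof -
  have "braket (U *v x) (U *v x) = braket x x"
    using assms by (simp add: braket_adjoint matrix_vector_mul_assoc unitary_mat_def)
  then have "(norm (U *v x))\<^sup>2 = (norm x)\<^sup>2"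
    by (simp only: braket_self of_real_eq_iff)
  then show ?thesis by simp
qed

lemma ket_decomp:
  fixes v :: "complex^(2 \<times> 'n::finite)"
  shows "v = ket0 \<otimes>\<^sub>v (\<chi> j. v $ (0, j)) + ket1 \<otimes>\<^sub>v (\<chi> j. v $ (1, j))"
  by (simp add: vec_eq_iff all_qubit)

text \<open>An operator on the first qubit mixes the two components by its rows, so work on qubit 1
  becomes linear algebra with the pair \<open>A\<close>, \<open>B\<close>.\<close>

lemma tensor_mat_kets:
  "(V \<otimes>\<^sub>m M) *v (ket0 \<otimes>\<^sub>v A + ket1 \<otimes>\<^sub>v B) =
    ket0 \<otimes>\<^sub>v (M *v (V $ 0 $ 0 *s A + V $ 0 $ 1 *s B)) + ket1 \<otimes>\<^sub>v (M *v (V $ 1 $ 0 *s A + V $ 1 $ 1 *s B))"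
  by (simp add: vec_eq_iff all_qubit matrix_vector_mult_def sum_pairs sum_qubit algebra_simps
      sum.distrib sum_distrib_left)

lemma norm_kets: "(norm (ket0 \<otimes>\<^sub>v A + ket1 \<otimes>\<^sub>v B))\<^sup>2 = (norm A)\<^sup>2 + (norm B)\<^sup>2"
proof -
  have "braket (ket0 \<otimes>\<^sub>v A + ket1 \<otimes>\<^sub>v B) (ket0 \<otimes>\<^sub>v A + ket1 \<otimes>\<^sub>v B) = braket A A + braket B B"
    by (simp add: braket_def sum_pairs sum_qubit)
  then show ?thesis
    unfolding braket_self of_real_add[symmetric] by (simp only: of_real_eq_iff)
qed

lemma reduced23_kets: "reduced23 (ket0 \<otimes>\<^sub>v A + ket1 \<otimes>\<^sub>v B) = projector A + projector B"
  by (simp add: vec_eq_iff reduced23_def trace_fst_def projector_def sum_qubit)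

text \<open>The columns of \<open>V\<close> are orthonormal, so the cross terms cancel: a unitary on
  qubit 1 only changes the ensemble that realizes the reduced state of qubits 2 and 3.\<close>

lemma unitary_row_mix_projector:
  fixes V :: "complex^2^2"
  assumes "unitary_mat V"
  shows "projector (V $ 0 $ 0 *s A + V $ 0 $ 1 *s B) + projector (V $ 1 $ 0 *s A + V $ 1 $ 1 *s B)
    = projector A + projector B"
proof -
  have "adjoint_mat V ** V = mat 1" using assms by (simp add: unitary_mat_def)
  then have V: "cnj (V$0$0) * V$0$0 + cnj (V$1$0) * V$1$0 = 1" "cnj (V$0$1) * V$0$1 + cnj (V$1$1) * V$1$1 = 1"
      "cnj (V$0$0) * V$0$1 + cnj (V$1$0) * V$1$1 = 0" "cnj (V$0$1) * V$0$0 + cnj (V$1$1) * V$1$0 = 0"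
    by (simp_all add: vec_eq_iff all_qubit adjoint_mat_def matrix_matrix_mult_def sum_qubit mat_def)
  show ?thesis
    unfolding vec_eq_iff
  proof (intro allI)
    fix i j
    show "(projector (V $ 0 $ 0 *s A + V $ 0 $ 1 *s B) + projector (V $ 1 $ 0 *s A + V $ 1 $ 1 *s B)) $ i $ j
      = (projector A + projector B) $ i $ j"
      unfolding projector_def using V by (simp, algebra)
  qed
qed

section \<open>Concurrence as twice the modulus of the determinant of the amplitude matrix\<close>

definition amp_det :: "qubits2 \<Rightarrow> complex"
  where "amp_det \<phi> = \<phi> $ (0, 0) * \<phi> $ (1, 1) - \<phi> $ (0, 1) * \<phi> $ (1, 0)"

text \<open>The spin flip exchanges the amplitudes 00 and 11, and 01 and 10, with opposite signs, so
  each product in the determinant occurs twice.\<close>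

lemma concurrence_amp_det: "concurrence \<phi> = 2 * cmod (amp_det \<phi>)"
proof -
  have "braket (spin_flip \<phi>) \<phi> = - 2 * amp_det \<phi>"
    by (simp add: braket_def spin_flip_def sum_pairs sum_qubit matrix_vector_mult_def sigma_y_def
        cnj_vec_def amp_det_def)
  then show ?thesis by (simp add: concurrence_def norm_mult)
qed

definition det22 :: "complex^2^2 \<Rightarrow> complex"
  where "det22 V = V $ 0 $ 0 * V $ 1 $ 1 - V $ 0 $ 1 * V $ 1 $ 0"

text \<open>The amplitude matrix M becomes V M W^T, and determinants multiply.\<close>

lemma amp_det_tensor: "amp_det ((V \<otimes>\<^sub>m W) *v \<phi>) = det22 V * det22 W * amp_det \<phi>"
  by (simp add: amp_det_def det22_def matrix_vector_mult_def sum_pairs sum_qubit) algebra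

lemma det22_mult: "det22 (A ** B) = det22 A * det22 B"
  by (simp add: det22_def matrix_matrix_mult_def sum_qubit) algebra

lemma cmod_det22_unitary:
  assumes "unitary_mat V"
  shows "cmod (det22 V) = 1"
proof -
  have "det22 (adjoint_mat V ** V) = 1"
    using assms by (simp add: unitary_mat_def det22_def mat_def)
  moreover have "det22 (adjoint_mat V) = cnj (det22 V)"
    by (simp add: det22_def adjoint_mat_def mult.commute)
  ultimately have "cnj (det22 V) * det22 V = 1" by (simp add: det22_mult)
  then have "of_real ((cmod (det22 V))\<^sup>2) = (1::complex)"
    by (simp only: complex_norm_square mult.commute)
  then have "(cmod (det22 V))\<^sup>2 = 1" by (simp only: of_real_eq_1_iff)
  then show ?thesis by (simp add: power2_eq_1_iff) (smt (verit) norm_ge_zero)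
qed

lemma concurrence_tensor_unitary:
  "unitary_mat V \<Longrightarrow> unitary_mat W \<Longrightarrow> concurrence ((V \<otimes>\<^sub>m W) *v \<phi>) = concurrence \<phi>"
  by (simp add: concurrence_amp_det amp_det_tensor norm_mult cmod_det22_unitary)

section \<open>Balancing the two components and the Schmidt decomposition\<close>

lemma unit_phase_abs:
  obtains w :: complex where "cmod w = 1" "w * z = of_real (cmod z)"
proof (cases "z = 0")
  case True
  then show ?thesis using that[of 1] by simp
next
  case False
  then show ?thesis using that[of "of_real (cmod z) / z"] by (simp add: norm_divide)
qed

lemma cmod_1_mult_cnj: "cmod w = 1 \<Longrightarrow> w * cnj w = 1"
  using complex_norm_square[of w] by simp

lemma braket_add_left: "braket (x + y) z = braket x z + braket y z"
  by (simp add: braket_def sum.distrib algebra_simps)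

lemma braket_add_right: "braket x (y + z) = braket x y + braket x z"
  by (simp add: braket_def sum.distrib algebra_simps)

lemma braket_scale_left: "braket (c *s x) y = cnj c * braket x y"
  by (simp add: braket_def sum_distrib_left algebra_simps)

lemma braket_scale_right: "braket x (c *s y) = c * braket x y"
  by (simp add: braket_def sum_distrib_left algebra_simps)

lemma cnj_braket: "cnj (braket x y) = braket y x"
  by (simp add: braket_def mult.commute)

lemma norm_cscale: "norm ((c::complex) *s x) = cmod c * norm x"
  by (simp add: norm_vec_def norm_mult L2_set_right_distrib)

lemma norm_ket [simp]: "norm ket0 = 1" "norm ket1 = 1"
  by (simp_all add: ket0_def ket1_def)

text \<open>A Jacobi rotation: after a phase that makes \<open>\<langle>A|B\<rangle>\<close> real, the overlap of the rotated
  vectors changes sign between the angles \<open>0\<close> and \<open>\<pi>/2\<close>.\<close>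

lemma unitary_orthogonalize:
  fixes A B :: "complex^'n"
  obtains V :: "complex^2^2" where "unitary_mat V"
    "braket (V $ 0 $ 0 *s A + V $ 0 $ 1 *s B) (V $ 1 $ 0 *s A + V $ 1 $ 1 *s B) = 0"
proof -
  obtain w where w: "cmod w = 1" and wc: "w * braket A B = of_real (cmod (braket A B))"
    by (rule unit_phase_abs)
  define p where "p = (norm A)\<^sup>2"
  define q where "q = (norm B)\<^sup>2"
  define r where "r = cmod (braket A B)"
  \<comment> \<open>The overlap of the two rotated vectors, once \<open>w\<close> has made both
    cross terms equal to \<open>r\<close>. It is \<open>r\<close> at angle 0 and \<open>- r\<close>
    at \<open>pi / 2\<close>.\<close>
  define g where "g t = cos t * sin t * (q - p) + r * ((cos t)\<^sup>2 - (sin t)\<^sup>2)" for t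
  have "\<exists>t. 0 \<le> t \<and> t \<le> pi / 2 \<and> g t = 0"
    by (rule IVT2') (auto simp: g_def r_def intro!: continuous_intros)
  then obtain t where t: "g t = 0" by blast
  let ?c = "of_real (cos t) :: complex" and ?s = "of_real (sin t) :: complex"
  let ?V = "mat2 ?c (?s * w) (- ?s) (?c * w)"
  have ww: "w * cnj w = 1" using w by (rule cmod_1_mult_cnj)
  have cs: "?c * ?c + ?s * ?s = 1"
    by (metis of_real_add of_real_mult of_real_1 power2_eq_square sin_cos_squared_add add.commute)
  have U: "unitary_mat ?V"
  proof (rule unitary_mat2)
    show "?c * cnj ?c + ?s * w * cnj (?s * w) = 1"
      using ww cs by (simp only: complex_cnj_mult complex_cnj_complex_of_real) algebra
    show "- ?s * cnj (- ?s) + ?c * w * cnj (?c * w) = 1"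
      using ww cs by (simp only: complex_cnj_mult complex_cnj_minus complex_cnj_complex_of_real) algebra
    show "?c * cnj (- ?s) + ?s * w * cnj (?c * w) = 0"
      using ww by (simp only: complex_cnj_mult complex_cnj_minus complex_cnj_complex_of_real) algebra
  qed
  have wc': "cnj w * braket B A = of_real r"
    using arg_cong[OF wc, of cnj] by (simp add: cnj_braket r_def)
  have "braket (?c *s A + (?s * w) *s B) (- ?s *s A + (?c * w) *s B)
      = - ?c * ?s * braket A A + ?c * ?c * (w * braket A B) - ?s * ?s * (cnj w * braket B A)
        + ?c * ?s * (w * cnj w) * braket B B"
    by (simp only: braket_add_left braket_add_right braket_scale_left braket_scale_right
        complex_cnj_mult complex_cnj_complex_of_real) algebra
  also have "\<dots> = of_real (g t)"
    unfolding wc wc' ww braket_self g_def r_def[symmetric] p_def[symmetric] q_def[symmetric]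
    by (simp add: algebra_simps power2_eq_square)
  finally show ?thesis using that[OF U] t by simp
qed

lemma amp_det_scale: "amp_det (c *s x) = c\<^sup>2 * amp_det x"
  by (simp add: amp_det_def power2_eq_square algebra_simps)

text \<open>Mixing twice is mixing by the product, so a suitable unitary on qubit 1 can be built in
  stages.\<close>

lemma unitary_kets_component:
  fixes V W :: "complex^2^2"
  shows "(V ** W) $ i $ 0 *s A + (V ** W) $ i $ 1 *s B =
    V $ i $ 0 *s (W $ 0 $ 0 *s A + W $ 0 $ 1 *s B) + V $ i $ 1 *s (W $ 1 $ 0 *s A + W $ 1 $ 1 *s B)"
  by (simp add: vec_eq_iff matrix_matrix_mult_def sum_qubit algebra_simps)

lemma balancing_unitary:
  fixes A B :: qubits2
  obtains V :: "complex^2^2" where "unitary_mat V"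
    "norm (V $ 0 $ 0 *s A + V $ 0 $ 1 *s B) = norm (V $ 1 $ 0 *s A + V $ 1 $ 1 *s B)"
    "concurrence (V $ 0 $ 0 *s A + V $ 0 $ 1 *s B) = concurrence (V $ 1 $ 0 *s A + V $ 1 $ 1 *s B)"
proof -
  obtain W :: "complex^2^2" where W: "unitary_mat W"
    "braket (W $ 0 $ 0 *s A + W $ 0 $ 1 *s B) (W $ 1 $ 0 *s A + W $ 1 $ 1 *s B) = 0"
    by (rule unitary_orthogonalize)
  define A' where "A' = W $ 0 $ 0 *s A + W $ 0 $ 1 *s B"
  define B' where "B' = W $ 1 $ 0 *s A + W $ 1 $ 1 *s B"
  have AB: "braket A' B' = 0" using W(2) by (simp add: A'_def B'_def)
  have BA: "braket B' A' = 0" using AB cnj_braket[of A' B'] by simp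
  define f where "f t = cmod (amp_det (A' + cis t *s B')) - cmod (amp_det (A' + (- cis t) *s B'))" for t
  have cont: "continuous_on S f" for S
    unfolding f_def amp_det_def cis_conv_exp by (simp, intro continuous_intros)
  \<comment> \<open>\<open>cis pi = - 1\<close> exchanges the two vectors compared in
    \<open>f\<close>.\<close>
  have f_pi: "f pi = - f 0" by (simp add: f_def)
  have "\<exists>t. f t = 0"
  proof (cases "f 0 \<le> 0")
    case True
    then show ?thesis using IVT'[of f 0 0 pi, OF _ _ _ cont] f_pi by auto
  next
    case False
    then show ?thesis using IVT2'[of f pi 0 0, OF _ _ _ cont] f_pi by auto
  qed
  then obtain t where t: "f t = 0" by blast
  \<comment> \<open>This factor makes \<open>?V\<close> unitary; it scales both components alike, so
    equality of norms and of concurrences survives.\<close>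
  let ?s = "of_real (1 / sqrt 2) :: complex"
  have ss: "?s * ?s = 1 / 2"
    by (simp flip: of_real_mult)
  have ee: "cis t * cnj (cis t) = 1" by (rule cmod_1_mult_cnj) simp
  let ?V = "mat2 ?s (?s * cis t) ?s (- ?s * cis t)"
  have cs: "cnj ?s = ?s" by (rule complex_cnj_complex_of_real)
  have V: "unitary_mat ?V"
    by (rule unitary_mat2; simp only: complex_cnj_mult complex_cnj_minus cs; use ss ee in algebra)
  have comps: "?V $ 0 $ 0 *s A' + ?V $ 0 $ 1 *s B' = ?s *s (A' + cis t *s B')"
      "?V $ 1 $ 0 *s A' + ?V $ 1 $ 1 *s B' = ?s *s (A' + (- cis t) *s B')"
    by (simp_all add: vec_eq_iff algebra_simps)
  \<comment> \<open>By orthogonality \<open>z\<close> enters only through its modulus, so the sign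
    in front of \<open>cis t\<close> does not affect the norm.\<close>
  have sq: "braket (A' + z *s B') (A' + z *s B') = braket A' A' + z * cnj z * braket B' B'" for z
    by (simp add: braket_add_left braket_add_right braket_scale_left braket_scale_right AB BA)
  have "braket (A' + cis t *s B') (A' + cis t *s B') = braket (A' + (- cis t) *s B') (A' + (- cis t) *s B')"
    unfolding sq by simp
  then have "norm (A' + cis t *s B') = norm (A' + (- cis t) *s B')"
    unfolding braket_self of_real_eq_iff by simp
  then have "norm (?V $ 0 $ 0 *s A' + ?V $ 0 $ 1 *s B') = norm (?V $ 1 $ 0 *s A' + ?V $ 1 $ 1 *s B')"
    unfolding comps norm_cscale by simp
  moreover have "concurrence (?V $ 0 $ 0 *s A' + ?V $ 0 $ 1 *s B') = concurrence (?V $ 1 $ 0 *s A' + ?V $ 1 $ 1 *s B')"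
    unfolding comps concurrence_amp_det amp_det_scale norm_mult using t by (simp add: f_def)
  ultimately show ?thesis
    using that[OF unitary_mult[OF V W(1)]]
    unfolding unitary_kets_component A'_def[symmetric] B'_def[symmetric] by blast
qed

text \<open>The first row of \<open>W\<close> is the conjugate of the normalized \<open>x\<close>.
  The orthogonal complement of \<open>x\<close> is a line, so \<open>y\<close> is then sent to a
  multiple of \<open>ket1\<close>, and the phase of the second row makes that multiple nonnegative.
  If \<open>x = 0\<close>, the norm condition forces \<open>y = 0\<close>.\<close>

lemma diagonalizing_unitary:
  fixes x y :: qubit
  assumes "braket x y = 0" "norm y \<le> norm x"
  obtains W where "unitary_mat W" "W *v x = of_real (norm x) *s ket0" "W *v y = of_real (norm y) *s ket1"
proof (cases "x = 0")
  case True
  then have "y = 0" using assms(2) by simp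
  then show ?thesis using that[OF unitary_one] True by simp
next
  case False
  define n where "n = complex_of_real (norm x)"
  define u where "u = (1 / n) *s x"
  have n: "n \<noteq> 0" "cnj n = n" using False by (simp_all add: n_def)
  have x: "x = n *s u" using n by (simp add: u_def vec_eq_iff)
  have "(norm u)\<^sup>2 = 1"
    using False by (simp add: u_def norm_cscale n_def norm_divide)
  then have "braket u u = 1" unfolding braket_self by simp
  then have uu: "u $ 0 * cnj (u $ 0) + u $ 1 * cnj (u $ 1) = 1"
    by (simp add: braket_def sum_qubit mult.commute)
  have uy: "cnj (u $ 0) * y $ 0 + cnj (u $ 1) * y $ 1 = 0"
    using assms(1) n by (simp add: x braket_scale_left) (simp add: braket_def sum_qubit)
  \<comment> \<open>Up to the phase \<open>w\<close>, the second row of \<open>?W\<close> applied to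
    \<open>y\<close>; its modulus is identified with \<open>norm y\<close> below because
    \<open>?W\<close> preserves norms.\<close>
  define d where "d = u $ 0 * y $ 1 - u $ 1 * y $ 0"
  obtain w where w: "cmod w = 1" and wd: "w * d = of_real (cmod d)"
    by (rule unit_phase_abs)
  have ww: "w * cnj w = 1" using w by (rule cmod_1_mult_cnj)
  let ?W = "mat2 (cnj (u $ 0)) (cnj (u $ 1)) (- w * u $ 1) (w * u $ 0)"
  have W: "unitary_mat ?W"
    by (rule unitary_mat2; simp; use uu ww in algebra)
  have Wx: "?W *v x = of_real (norm x) *s ket0"
    unfolding n_def[symmetric] using uu
    by (simp add: x vec_eq_iff all_qubit matrix_vector_mult_def sum_qubit) algebra
  have Wy: "?W *v y = of_real (cmod d) *s ket1"
    unfolding wd[symmetric] unfolding d_def using uy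
    by (simp add: vec_eq_iff all_qubit matrix_vector_mult_def sum_qubit algebra_simps)
  have "norm (?W *v y) = cmod d"
    unfolding Wy norm_cscale by simp
  then have "cmod d = norm y" using norm_unitary[OF W] by metis
  then show ?thesis using that[OF W Wx] Wy by simp
qed

text \<open>A singular value decomposition of the amplitude matrix: \<open>V\<close> makes its rows
  orthogonal, \<open>W\<close> turns them onto the axes, and the row norms are the
  coefficients.\<close>

lemma schmidt_decomposition:
  fixes \<phi> :: qubits2
  obtains V W a b where "unitary_mat V" "unitary_mat W" "a \<ge> b" "b \<ge> 0"
    "(V \<otimes>\<^sub>m W) *v \<phi> = schmidt_state a b"
proof -
  define r0 where "r0 = (\<chi> j. \<phi> $ (0, j))"
  define r1 where "r1 = (\<chi> j. \<phi> $ (1, j))"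
  have \<phi>: "\<phi> = ket0 \<otimes>\<^sub>v r0 + ket1 \<otimes>\<^sub>v r1"
    unfolding r0_def r1_def by (rule ket_decomp)
  let ?x = "\<lambda>V::complex^2^2. V $ 0 $ 0 *s r0 + V $ 0 $ 1 *s r1"
  let ?y = "\<lambda>V::complex^2^2. V $ 1 $ 0 *s r0 + V $ 1 $ 1 *s r1"
  obtain V0 :: "complex^2^2" where V0: "unitary_mat V0" "braket (?x V0) (?y V0) = 0"
    by (rule unitary_orthogonalize)
  obtain V :: "complex^2^2" where V: "unitary_mat V" "braket (?x V) (?y V) = 0" "norm (?y V) \<le> norm (?x V)"
  proof (cases "norm (?y V0) \<le> norm (?x V0)")
    case True
    then show ?thesis using that V0 by blast
  next
    case False
    \<comment> \<open>Exchanging the basis states of the first qubit swaps the two rows and so puts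
      the longer one first.\<close>
    let ?S = "mat2 0 1 1 0 ** V0"
    have "unitary_mat (mat2 0 1 1 0)" by (rule unitary_mat2) simp_all
    then have "unitary_mat ?S" using V0(1) by (rule unitary_mult)
    moreover have "?x ?S = ?y V0" "?y ?S = ?x V0"
      unfolding unitary_kets_component by simp_all
    moreover have "braket (?y V0) (?x V0) = 0"
      using V0(2) by (metis cnj_braket complex_cnj_zero)
    ultimately show ?thesis using that False by (metis linorder_linear)
  qed
  obtain W where W: "unitary_mat W" "W *v ?x V = of_real (norm (?x V)) *s ket0"
      "W *v ?y V = of_real (norm (?y V)) *s ket1"
    using diagonalizing_unitary[OF V(2,3)] by blast
  have "(V \<otimes>\<^sub>m W) *v \<phi> = schmidt_state (norm (?x V)) (norm (?y V))"
    unfolding \<phi> tensor_mat_kets W schmidt_state_def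
    by (simp add: vec_eq_iff algebra_simps)
  then show ?thesis using that[OF V(1) W(1) V(3)] by simp
qed

lemma norm_schmidt_state: "(norm (schmidt_state a b))\<^sup>2 = a\<^sup>2 + b\<^sup>2"
proof -
  have "schmidt_state a b = ket0 \<otimes>\<^sub>v (of_real a *s ket0) + ket1 \<otimes>\<^sub>v (of_real b *s ket1)"
    by (simp add: schmidt_state_def vec_eq_iff algebra_simps)
  then show ?thesis by (simp add: norm_kets norm_cscale)
qed

lemma concurrence_schmidt_state: "concurrence (schmidt_state a b) = 2 * \<bar>a * b\<bar>"
  by (simp add: concurrence_amp_det amp_det_def schmidt_state_def norm_mult abs_mult)

text \<open>The data fix the squares of the sum and of the difference, both of which are
  nonnegative.\<close>

lemma schmidt_coefficients_unique:
  fixes a b c d :: real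
  assumes "a \<ge> b" "b \<ge> 0" "c \<ge> d" "d \<ge> 0" "a\<^sup>2 + b\<^sup>2 = c\<^sup>2 + d\<^sup>2" "a * b = c * d"
  shows "a = c \<and> b = d"
proof -
  have "(a + b)\<^sup>2 = (c + d)\<^sup>2" "(a - b)\<^sup>2 = (c - d)\<^sup>2"
    using assms by (simp_all add: power2_sum power2_diff)
  then have "a + b = c + d" "a - b = c - d"
    using assms by simp_all
  then show ?thesis by linarith
qed

section \<open>Euler angles\<close>

lemma mat_exp_of_sums:
  assumes "(\<lambda>k. (1 / fact k) *\<^sub>R mat_pow A k) sums M"
  shows "mat_exp A = M"
  using assms by (simp add: mat_exp_def sums_iff)

lemma mat_scale_nth [simp]: "mat_scale c A $ i $ j = c * A $ i $ j"
  by (simp add: mat_scale_def)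

text \<open>An involution \<open>\<sigma>\<close> acts as \<open>\<plusminus>1\<close> on the ranges of the projections \<open>(1 \<plusminus> \<sigma>)/2\<close>.\<close>

lemma mat_exp_involution:
  fixes \<sigma> :: "complex^'n^'n"
  assumes "\<sigma> ** \<sigma> = mat 1"
  shows "mat_exp (mat_scale c \<sigma>) =
    mat_scale (exp c) (mat_scale (1 / 2) (mat 1 + \<sigma>)) + mat_scale (exp (- c)) (mat_scale (1 / 2) (mat 1 - \<sigma>))"
proof (rule mat_exp_of_sums)
  define P where "P = mat_scale (1 / 2) (mat 1 + \<sigma>)"
  define Q where "Q = mat_scale (1 / 2) (mat 1 - \<sigma>)"
  have lin: "\<sigma> ** mat_scale z M = mat_scale z (\<sigma> ** M)" "mat_scale z \<sigma> ** M = mat_scale z (\<sigma> ** M)" for z M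
    by (simp_all add: vec_eq_iff matrix_matrix_mult_def sum_distrib_left mult_ac)
  have add: "\<sigma> ** (M + N) = \<sigma> ** M + \<sigma> ** N" "\<sigma> ** (M - N) = \<sigma> ** M - \<sigma> ** N" for M N
    by (simp_all add: vec_eq_iff matrix_matrix_mult_def sum.distrib sum_subtractf algebra_simps)
  have "\<sigma> ** P = P" "\<sigma> ** Q = mat_scale (- 1) Q"
    unfolding P_def Q_def lin add assms by (simp_all add: vec_eq_iff)
  moreover have "mat 1 = P + Q"
    by (simp add: P_def Q_def vec_eq_iff field_simps)
  ultimately have pow: "mat_pow (mat_scale c \<sigma>) k = mat_scale (c ^ k) P + mat_scale ((- c) ^ k) Q" for k
  proof (induction k)
    case 0
    then show ?case by (simp add: vec_eq_iff)
  next
    case (Suc k)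
    then show ?case by (simp add: add lin) (simp add: vec_eq_iff algebra_simps)
  qed
  have "(\<lambda>k. (1 / fact k) *\<^sub>R mat_pow (mat_scale c \<sigma>) k) =
      (\<lambda>k. mat_scale (c ^ k /\<^sub>R fact k) P + mat_scale ((- c) ^ k /\<^sub>R fact k) Q)"
    unfolding pow by (simp add: fun_eq_iff vec_eq_iff algebra_simps divide_inverse)
  \<comment> \<open>Scaling a fixed matrix is bounded linear in the scalar, so it carries the scalar
    exponential series to a matrix series.\<close>
  moreover have "(\<lambda>k. mat_scale (z ^ k /\<^sub>R fact k) M) sums mat_scale (exp z) M" for z and M :: "complex^'n^'n"
  proof (rule bounded_linear.sums[OF _ exp_converges])
    have "linear (\<lambda>z. mat_scale z M)"
      by (rule linearI) (simp_all add: vec_eq_iff algebra_simps)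
    then show "bounded_linear (\<lambda>z. mat_scale z M)"
      by (simp add: linear_conv_bounded_linear)
  qed
  ultimately show "(\<lambda>k. (1 / fact k) *\<^sub>R mat_pow (mat_scale c \<sigma>) k) sums (mat_scale (exp c) P + mat_scale (exp (- c)) Q)"
    by (simp only: sums_add)
qed

lemma Zrot_eq: "Zrot \<xi> = mat2 (cis \<xi>) 0 0 (cnj (cis \<xi>))"
proof -
  have "sigma_z ** sigma_z = mat 1"
    by (simp add: sigma_z_def mat2_mult mat2_one)
  then show ?thesis
    unfolding Zrot_def by (subst mat_exp_involution)
      (simp_all add: vec_eq_iff all_qubit sigma_z_def mat_def cis_conv_exp exp_cnj)
qed

lemma Yrot_eq: "Yrot \<xi> = mat2 (cos \<xi>) (sin \<xi>) (- sin \<xi>) (cos \<xi>)"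
proof -
  have "sigma_y ** sigma_y = mat 1"
    by (simp add: sigma_y_def mat2_mult mat2_one)
  then show ?thesis
    unfolding Yrot_def by (subst mat_exp_involution)
      (simp_all add: vec_eq_iff all_qubit sigma_y_def mat_def complex_eq_iff Re_exp Im_exp)
qed

text \<open>\<open>Zrot\<close> with its angle replaced by a unit complex number: phases can be
  multiplied freely, and a range for the angle is imposed only at the end.\<close>

definition phase_mat :: "complex \<Rightarrow> complex^2^2"
  where "phase_mat z = mat2 z 0 0 (cnj z)"

lemma cis_Arg_unit: "cmod z = 1 \<Longrightarrow> cis (Arg z) = z"
  using rcis_cmod_Arg[of z] by (simp add: rcis_def)

text \<open>Shifting the angle by \<open>pi\<close> changes only the sign of \<open>Zrot\<close>, so
  a half-open interval of length \<open>pi\<close> suffices once the sign \<open>s\<close> is split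
  off.\<close>

lemma phase_mat_Zrot:
  assumes "cmod z = 1"
  obtains \<xi> s :: real where "\<xi> \<in> {- pi / 2 <.. pi / 2}" "s\<^sup>2 = 1" "phase_mat z = mat_scale s (Zrot \<xi>)"
proof -
  have z: "z = cis (Arg z)"
    using assms by (simp add: cis_Arg_unit)
  have bnd: "- pi < Arg z" "Arg z \<le> pi" using Arg_bounded by auto
  have sh: "phase_mat z = mat_scale (-1) (Zrot \<xi>)" if "Arg z = \<xi> + pi \<or> Arg z = \<xi> - pi" for \<xi>
  proof -
    have "z = - cis \<xi>"
      using that by (subst z) (auto simp: complex_eq_iff)
    then show ?thesis by (simp add: phase_mat_def Zrot_eq vec_eq_iff all_qubit)
  qed
  consider "Arg z \<le> - pi / 2" | "- pi / 2 < Arg z" "Arg z \<le> pi / 2" | "pi / 2 < Arg z" by linarith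
  then show ?thesis
  proof cases
    case 1
    then show ?thesis using that[of "Arg z + pi" "-1"] sh[of "Arg z + pi"] bnd by simp
  next
    case 2
    have "phase_mat z = mat_scale 1 (Zrot (Arg z))"
      unfolding phase_mat_def Zrot_eq z[symmetric] by (simp add: vec_eq_iff all_qubit)
    then show ?thesis using that[of "Arg z" 1] 2 by simp
  next
    case 3
    then show ?thesis using that[of "Arg z - pi" "-1"] sh[of "Arg z - pi"] bnd by simp
  qed
qed

lemma unitary_euler:
  assumes "unitary_mat U"
  obtains w z1 z2 \<beta> where "cmod w = 1" "cmod z1 = 1" "cmod z2 = 1" "\<beta> \<in> {0..pi / 2}"
    "U = mat_scale w (phase_mat z1 ** Yrot \<beta> ** phase_mat z2)"
proof -
  define D where "D = det22 U"
  have "cmod D = 1" unfolding D_def using assms by (rule cmod_det22_unitary)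
  then obtain d where d: "D = cis d" using cis_Arg_unit by metis
  define w where "w = cis (d / 2)"
  have w: "cmod w = 1" "w * w = D" by (simp_all add: w_def d cis_mult)
  have wc: "w * cnj w = 1" by (simp add: w_def cis_cnj cis_mult)
  obtain p q r s where U: "U = mat2 p q r s" by (metis mat2_eta)
  have Dps: "D = p * s - q * r" by (simp add: D_def U det22_def)
  have e: "cnj p * p + cnj r * r = 1" "cnj q * q + cnj s * s = 1" "cnj p * q + cnj r * s = 0"
      "cnj q * p + cnj s * r = 0" "p * cnj p + q * cnj q = 1"
    using assms by (simp_all add: unitary_mat_def U adjoint_mat2 mat2_mult mat2_one mat2_eq_iff)
  \<comment> \<open>Unitarity makes the adjoint equal to the adjugate divided by
    \<open>D\<close>.\<close>
  have sr: "s = D * cnj p" "r = - D * cnj q" unfolding Dps using e by algebra+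
  define u where "u = cnj w * p"
  define v where "v = cnj w * q"
  have pq: "p = w * u" "q = w * v" using wc by (simp_all add: u_def v_def mult.assoc[symmetric])
  have rs: "s = w * cnj u" "r = - w * cnj v"
    by (simp_all add: sr u_def v_def w(2)[symmetric])
  have "u * cnj u + v * cnj v = 1" unfolding u_def v_def using e(5) wc by (simp, algebra)
  then have "of_real ((cmod u)\<^sup>2 + (cmod v)\<^sup>2) = (1::complex)"
    by (simp only: of_real_add complex_norm_square)
  then have uv: "(cmod u)\<^sup>2 + (cmod v)\<^sup>2 = 1" by (simp only: of_real_eq_1_iff)
  then have "cmod u \<le> 1"
    by (metis abs_norm_cancel abs_square_le_1 le_add_same_cancel1 zero_le_power2)
  define \<beta> where "\<beta> = arccos (cmod u)"
  have cb: "cos \<beta> = cmod u" unfolding \<beta>_def using \<open>cmod u \<le> 1\<close>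
    by (intro cos_arccos) (auto intro: order_trans[OF _ norm_ge_zero])
  have \<beta>: "\<beta> \<in> {0..pi / 2}"
    unfolding \<beta>_def using \<open>cmod u \<le> 1\<close> arccos_lbound[of "cmod u"] arccos_le_pi2[of "cmod u"] norm_ge_zero[of u]
    by simp
  then have "sin \<beta> \<ge> 0" by (intro sin_ge_zero) auto
  moreover have "(sin \<beta>)\<^sup>2 = (cmod v)\<^sup>2"
    using uv cb sin_cos_squared_add[of \<beta>] by simp
  ultimately have sb: "sin \<beta> = cmod v" by simp
  define x where "x = Arg u"
  define y where "y = Arg v"
  have u: "of_real (cmod u) * cis x = u" and v: "of_real (cmod v) * cis y = v"
    unfolding x_def y_def using rcis_cmod_Arg[of u] rcis_cmod_Arg[of v] by (simp_all only: rcis_def)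
  have cu: "of_real (cmod u) * cis (- x) = cnj u" and cv: "of_real (cmod v) * cis (- y) = cnj v"
    using u[THEN arg_cong, of cnj] v[THEN arg_cong, of cnj] by (simp_all only: complex_cnj_mult complex_cnj_complex_of_real cis_cnj)
  \<comment> \<open>Half sum and half difference solve \<open>z1 * z2 = cis x\<close> and
    \<open>z1 * cnj z2 = cis y\<close>. If \<open>u\<close> or \<open>v\<close> vanishes, its
    argument is immaterial, as it is multiplied by the modulus 0.\<close>
  define z1 where "z1 = cis ((x + y) / 2)"
  define z2 where "z2 = cis ((x - y) / 2)"
  have z: "z1 * z2 = cis x" "z1 * cnj z2 = cis y"
    by (simp_all add: z1_def z2_def cis_mult cis_cnj diff_divide_distrib add_divide_distrib)
  have cz: "cnj z1 * cnj z2 = cis (- x)" "cnj z1 * z2 = cis (- y)"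
    using z[THEN arg_cong, of cnj] by (simp_all add: cis_cnj)
  have "phase_mat z1 ** Yrot \<beta> ** phase_mat z2 = mat2 (cmod u * (z1 * z2)) (cmod v * (z1 * cnj z2))
      (- cmod v * (cnj z1 * z2)) (cmod u * (cnj z1 * cnj z2))"
    unfolding phase_mat_def Yrot_eq cb sb mat2_mult by (simp add: mult_ac)
  also have "\<dots> = mat2 u v (- cnj v) (cnj u)"
    unfolding z cz mat2_eq_iff u v cu by (simp add: cv)
  finally have "U = mat_scale w (phase_mat z1 ** Yrot \<beta> ** phase_mat z2)"
    by (simp add: U pq rs vec_eq_iff all_qubit)
  then show ?thesis using that[of w z1 z2 \<beta>] w \<beta> by (simp add: z1_def z2_def)
qed

lemma unitary_phase_mat: "cmod z = 1 \<Longrightarrow> unitary_mat (phase_mat z)"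
  unfolding phase_mat_def using complex_norm_square[of z]
  by (intro unitary_mat2) (simp_all add: mult.commute)

section \<open>Entropy and ensembles\<close>

text \<open>If \<open>x = y\<close>, the root set collapses to one point, but its order is 2;
  counting with multiplicity makes both cases agree.\<close>

lemma sum_roots_order_mult:
  fixes f :: "complex \<Rightarrow> real"
  shows "(\<Sum>z | poly ([:- x, 1:] * [:- y, 1:]) z = 0. real (order z ([:- x, 1:] * [:- y, 1:])) * f z) = f x + f y"
proof -
  let ?p = "[:- x, 1:] * [:- y, 1:]"
  have ord: "order z ?p = (if z = x then 1 else 0) + (if z = y then 1 else 0)" for z
  proof -
    have lin: "order z [:- w, 1:] = (if z = w then 1 else 0)" for w
      using order_power_n_n[of w 1] by (auto intro: order_0I)
    have "?p \<noteq> 0" by (rule no_zero_divisors) simp_all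
    from order_mult[OF this, of z] show ?thesis unfolding lin .
  qed
  have "poly [:- w, 1:] z = 0 \<longleftrightarrow> z = w" for w z :: complex
    by (simp add: add_eq_0_iff)
  then have roots: "{z. poly ?p z = 0} = {x, y}"
    unfolding poly_mult mult_eq_0_iff by auto
  show ?thesis
    unfolding roots ord by (cases "x = y") auto
qed

lemma det_qubit: "det (A :: 'a::comm_ring_1^2^2) = A $ 0 $ 0 * A $ 1 $ 1 - A $ 0 $ 1 * A $ 1 $ 0"
proof -
  have two: "(2::2) = 0" by simp
  show ?thesis unfolding det_2 two by simp
qed

lemma entanglement_schmidt_state:
  "entanglement (schmidt_state a b) = - (a\<^sup>2 * log 2 (a\<^sup>2)) - b\<^sup>2 * log 2 (b\<^sup>2)"
proof -
  have "trace_snd (projector (schmidt_state a b)) = mat2 (of_real (a\<^sup>2)) 0 0 (of_real (b\<^sup>2))"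
    by (simp add: vec_eq_iff all_qubit trace_snd_def projector_def sum_qubit schmidt_state_def
        power2_eq_square)
  moreover have "charpoly (mat2 x 0 0 y) = [:- x, 1:] * [:- y, 1:]" for x y
    by (simp add: charpoly_def det_qubit)
  ultimately show ?thesis
    by (simp only: entanglement_def vn_entropy_def sum_roots_order_mult) simp
qed

text \<open>Normalization turns \<open>1 - (2 * (a * b))\<^sup>2\<close> into the square of
  \<open>a\<^sup>2 - b\<^sup>2\<close>, and the order of the coefficients selects this root.\<close>

lemma entanglement_schmidt_state_conc:
  assumes "a \<ge> b" "b \<ge> 0" "a\<^sup>2 + b\<^sup>2 = 1"
  shows "entanglement (schmidt_state a b) = ent_of_conc (2 * (a * b))"
proof -
  have "1 - (2 * (a * b))\<^sup>2 = (a\<^sup>2 + b\<^sup>2)\<^sup>2 - (2 * (a * b))\<^sup>2" using assms(3) by simp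
  also have "\<dots> = (a\<^sup>2 - b\<^sup>2)\<^sup>2" by algebra
  finally have "1 - (2 * (a * b))\<^sup>2 = (a\<^sup>2 - b\<^sup>2)\<^sup>2" .
  moreover have "b\<^sup>2 \<le> a\<^sup>2" using assms by (simp add: power_mono)
  ultimately have "sqrt (1 - (2 * (a * b))\<^sup>2) = a\<^sup>2 - b\<^sup>2" by simp
  then have "(1 + sqrt (1 - (2 * (a * b))\<^sup>2)) / 2 = a\<^sup>2" using assms(3) by (simp add: field_simps)
  moreover have "1 - a\<^sup>2 = b\<^sup>2" using assms(3) by simp
  ultimately show ?thesis
    by (simp only: ent_of_conc_def binary_entropy_def entanglement_schmidt_state)
qed

text \<open>The derivative is the base-2 logarithm of \<open>(1 - t) / t\<close>, nonpositive from
  1/2 on. The endpoint 1, where it diverges, is treated apart: the entropy is 0 there and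
  nonnegative elsewhere.\<close>

lemma binary_entropy_antimono:
  assumes "1 / 2 \<le> x" "x \<le> y" "y \<le> 1"
  shows "binary_entropy y \<le> binary_entropy x"
proof (cases "y = 1")
  case True
  have "x * log 2 x \<le> 0" "(1 - x) * log 2 (1 - x) \<le> 0"
    using assms by (cases "x = 1"; auto intro!: mult_nonneg_nonpos simp: log_le_zero_cancel_iff)+
  then show ?thesis using True by (simp add: binary_entropy_def)
next
  case False
  show ?thesis
  proof (rule DERIV_nonpos_imp_nonincreasing[OF assms(2)])
    fix t assume t: "x \<le> t" "t \<le> y"
    then have t': "1 / 2 \<le> t" "t < 1" using assms False by auto
    have "(binary_entropy has_real_derivative (ln (1 - t) - ln t) / ln 2) (at t)"
      unfolding binary_entropy_def log_def using t'
      by (auto intro!: derivative_eq_intros simp: add_divide_distrib diff_divide_distrib)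
    moreover have "(ln (1 - t) - ln t) / ln 2 \<le> 0"
      using t' by (intro divide_nonpos_pos) auto
    ultimately show "\<exists>D. (binary_entropy has_real_derivative D) (at t) \<and> D \<le> 0" by blast
  qed
qed

text \<open>Two decreasing maps are composed: a larger concurrence moves the argument of the binary
  entropy down towards 1/2.\<close>

lemma ent_of_conc_mono:
  assumes "0 \<le> c" "c \<le> d" "d \<le> 1"
  shows "ent_of_conc c \<le> ent_of_conc d"
  unfolding ent_of_conc_def
proof (rule binary_entropy_antimono)
  have d: "d\<^sup>2 \<le> 1" using assms by (simp add: abs_square_le_1)
  then show "1 / 2 \<le> (1 + sqrt (1 - d\<^sup>2)) / 2" by simp
  have "c\<^sup>2 \<le> d\<^sup>2" using assms by (simp add: power_mono)
  then show "(1 + sqrt (1 - d\<^sup>2)) / 2 \<le> (1 + sqrt (1 - c\<^sup>2)) / 2" by simp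
  show "(1 + sqrt (1 - c\<^sup>2)) / 2 \<le> 1" by simp
qed

section \<open>Ensembles and their extremal average concurrences\<close>

lemma concurrence_le_norm: "concurrence \<phi> \<le> (norm \<phi>)\<^sup>2"
proof -
  have norm: "(norm \<phi>)\<^sup>2 = (cmod (\<phi> $ (0,0)))\<^sup>2 + (cmod (\<phi> $ (0,1)))\<^sup>2 + (cmod (\<phi> $ (1,0)))\<^sup>2 + (cmod (\<phi> $ (1,1)))\<^sup>2"
    by (simp add: norm_vec_def L2_set_def sum_pairs sum_qubit)
  \<comment> \<open>Applied to the amplitude pairs 00, 11 and 01, 10, whose products make up the
    determinant.\<close>
  have amgm: "2 * (x * y) \<le> x\<^sup>2 + y\<^sup>2" for x y :: real
    using sum_squares_bound[of x y] by simp
  have "concurrence \<phi> \<le> 2 * (cmod (\<phi> $ (0,0)) * cmod (\<phi> $ (1,1))) + 2 * (cmod (\<phi> $ (0,1)) * cmod (\<phi> $ (1,0)))"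
    using norm_triangle_ineq4[of "\<phi> $ (0,0) * \<phi> $ (1,1)" "\<phi> $ (0,1) * \<phi> $ (1,0)"]
    by (simp add: concurrence_amp_det amp_det_def norm_mult)
  also have "\<dots> \<le> (norm \<phi>)\<^sup>2"
    unfolding norm using amgm[of "cmod (\<phi> $ (0,0))" "cmod (\<phi> $ (1,1))"]
      amgm[of "cmod (\<phi> $ (0,1))" "cmod (\<phi> $ (1,0))"] by linarith
  finally show ?thesis .
qed

lemma ensemble_concurrences_bounds:
  assumes "c \<in> ensemble_concurrences \<rho>"
  shows "0 \<le> c" "c \<le> 1"
proof -
  obtain n \<pi> \<phi> where c: "c = (\<Sum>j<n. \<pi> j * concurrence (\<phi> j))" and e: "pure_ensemble \<rho> n \<pi> \<phi>"
    using assms by (auto simp: ensemble_concurrences_def)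
  have \<pi>: "\<And>j. j < n \<Longrightarrow> 0 \<le> \<pi> j \<and> norm (\<phi> j) = 1" "(\<Sum>j<n. \<pi> j) = 1"
    using e by (auto simp: pure_ensemble_def)
  have con: "0 \<le> concurrence (\<phi> j) \<and> concurrence (\<phi> j) \<le> 1" if "j < n" for j
    using concurrence_le_norm[of "\<phi> j"] \<pi>(1)[OF that] by (simp add: concurrence_def)
  show "0 \<le> c" unfolding c using \<pi> con by (intro sum_nonneg) auto
  have "c \<le> (\<Sum>j<n. \<pi> j * 1)" unfolding c using \<pi> con by (intro sum_mono mult_left_mono) auto
  then show "c \<le> 1" using \<pi> by simp
qed

text \<open>Each pure state gives a point (projector, concurrence), and ensembles are the convex
  combinations of such points. The attainable averages thus form the fibre over
  \<open>\<rho>\<close> of a convex hull.\<close>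

lemma ensemble_concurrences_hull:
  "ensemble_concurrences \<rho> = {c. (\<rho>, c) \<in> convex hull ((\<lambda>\<phi>. (projector \<phi>, concurrence \<phi>)) ` sphere 0 1)}"
    (is "_ = {c. (\<rho>, c) \<in> convex hull (?f ` _)}")
proof (intro set_eqI iffI)
  fix c assume "c \<in> ensemble_concurrences \<rho>"
  then obtain n \<pi> \<phi> where c: "c = (\<Sum>j<n. \<pi> j * concurrence (\<phi> j))" and "pure_ensemble \<rho> n \<pi> \<phi>"
    by (auto simp: ensemble_concurrences_def)
  then have e: "\<And>j. j < n \<Longrightarrow> 0 \<le> \<pi> j \<and> norm (\<phi> j) = 1" "(\<Sum>j<n. \<pi> j) = 1"
      "\<rho> = (\<Sum>j<n. \<pi> j *\<^sub>R projector (\<phi> j))"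
    by (auto simp: pure_ensemble_def)
  have "(\<Sum>j<n. \<pi> j *\<^sub>R ?f (\<phi> j)) \<in> convex hull (?f ` sphere 0 1)"
    using e by (intro convex_sum) (auto intro!: hull_inc)
  moreover have "(\<Sum>j<n. \<pi> j *\<^sub>R ?f (\<phi> j)) = (\<rho>, c)"
    by (simp add: prod_eq_iff fst_sum snd_sum e(3) c)
  ultimately show "c \<in> {c. (\<rho>, c) \<in> convex hull (?f ` sphere 0 1)}" by simp
next
  fix c assume "c \<in> {c. (\<rho>, c) \<in> convex hull (?f ` sphere 0 1)}"
  then obtain k u x where u: "\<forall>i\<in>{1..k::nat}. 0 \<le> u i \<and> x i \<in> ?f ` sphere 0 1" "sum u {1..k} = 1"
      "(\<Sum>i=1..k. u i *\<^sub>R x i) = (\<rho>, c)"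
    unfolding convex_hull_indexed by auto
  then have "\<forall>i. \<exists>\<phi>. i \<in> {1..k} \<longrightarrow> norm \<phi> = 1 \<and> x i = ?f \<phi>" by fastforce
  then obtain \<phi> where \<phi>: "\<And>i. i \<in> {1..k} \<Longrightarrow> norm (\<phi> i) = 1 \<and> x i = ?f (\<phi> i)" by metis
  \<comment> \<open>The convex hull numbers its points from 1, ensembles from 0.\<close>
  have reindex: "(\<Sum>i=1..k. g i) = (\<Sum>j<k. g (Suc j))" for g :: "nat \<Rightarrow> 'z::comm_monoid_add"
    by (rule sum.reindex_bij_witness[of _ Suc "\<lambda>i. i - 1"]) auto
  have "(\<rho>, c) = (\<Sum>i=1..k. u i *\<^sub>R ?f (\<phi> i))"
    unfolding u(3)[symmetric] using \<phi> by (intro sum.cong) auto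
  then have "\<rho> = (\<Sum>j<k. u (Suc j) *\<^sub>R projector (\<phi> (Suc j)))" "c = (\<Sum>j<k. u (Suc j) * concurrence (\<phi> (Suc j)))"
    unfolding reindex by (simp_all add: prod_eq_iff fst_sum snd_sum)
  moreover have "\<forall>j<k. 0 \<le> u (Suc j) \<and> norm (\<phi> (Suc j)) = 1"
    using u(1) \<phi> by auto
  moreover have "(\<Sum>j<k. u (Suc j)) = 1" using u(2) unfolding reindex .
  ultimately show "c \<in> ensemble_concurrences \<rho>"
    unfolding ensemble_concurrences_def pure_ensemble_def mem_Collect_eq
    by (intro exI[of _ k] exI[of _ "\<lambda>j. u (Suc j)"] exI[of _ "\<lambda>j. \<phi> (Suc j)"]) simp
qed

text \<open>In finite dimension the convex hull of a compact set is compact; so are its slice at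
  \<open>\<rho>\<close> and the projection of that slice.\<close>

lemma compact_ensemble_concurrences: "compact (ensemble_concurrences \<rho>)"
proof -
  let ?f = "\<lambda>\<phi>. (projector \<phi>, concurrence \<phi>)"
  have "continuous_on (sphere 0 1) ?f"
    unfolding projector_def concurrence_amp_det amp_det_def by (intro continuous_intros)
  then have "compact (?f ` sphere 0 1)" by (intro compact_continuous_image compact_sphere)
  then have "compact (convex hull (?f ` sphere 0 1) \<inter> {\<rho>} \<times> UNIV)"
    by (intro compact_Int_closed compact_convex_hull closed_Times) auto
  then have "compact (snd ` (convex hull (?f ` sphere 0 1) \<inter> {\<rho>} \<times> UNIV))"
    by (intro compact_continuous_image continuous_on_snd continuous_on_id)
  moreover have "snd ` (convex hull (?f ` sphere 0 1) \<inter> {\<rho>} \<times> UNIV) = ensemble_concurrences \<rho>"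
    unfolding ensemble_concurrences_hull by force
  ultimately show ?thesis by simp
qed

text \<open>Compactness, with \<open>c\<close> as a witness of nonemptiness, makes both extrema
  attained, so that \<open>LEAST\<close> and \<open>GREATEST\<close> denote them. The bounds 0 and 1
  place them where the entropy function is monotone.\<close>

lemma extremal_concurrence_bounds:
  assumes "c \<in> ensemble_concurrences \<rho>"
  shows "0 \<le> mixed_concurrence \<rho>" "mixed_concurrence \<rho> \<le> c"
    "c \<le> concurrence_of_assistance \<rho>" "concurrence_of_assistance \<rho> \<le> 1"
proof -
  let ?S = "ensemble_concurrences \<rho>"
  have "?S \<noteq> {}" using assms by auto
  obtain m where m: "m \<in> ?S" "\<forall>x\<in>?S. m \<le> x"
    using compact_attains_inf[OF compact_ensemble_concurrences \<open>?S \<noteq> {}\<close>] by blast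
  obtain M where M: "M \<in> ?S" "\<forall>x\<in>?S. x \<le> M"
    using compact_attains_sup[OF compact_ensemble_concurrences \<open>?S \<noteq> {}\<close>] by blast
  have "mixed_concurrence \<rho> = m"
    unfolding mixed_concurrence_def using m by (intro Least_equality) auto
  then show "0 \<le> mixed_concurrence \<rho>" "mixed_concurrence \<rho> \<le> c"
    using m assms ensemble_concurrences_bounds by auto
  have "concurrence_of_assistance \<rho> = M"
    unfolding concurrence_of_assistance_def using M by (intro Greatest_equality) auto
  then show "c \<le> concurrence_of_assistance \<rho>" "concurrence_of_assistance \<rho> \<le> 1"
    using M assms ensemble_concurrences_bounds by auto
qed

section \<open>The canonical form\<close>

lemma LU_equivalent_trans:
  assumes "LU_equivalent \<psi> \<psi>'" "LU_equivalent \<psi>' \<psi>''"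
  shows "LU_equivalent \<psi> \<psi>''"
proof -
  obtain V1 V2 V3 where V: "unitary_mat V1" "unitary_mat V2" "unitary_mat V3"
      "\<psi>' = (V1 \<otimes>\<^sub>m V2 \<otimes>\<^sub>m V3) *v \<psi>"
    using assms(1) by (auto simp: LU_equivalent_def)
  obtain W1 W2 W3 where W: "unitary_mat W1" "unitary_mat W2" "unitary_mat W3"
      "\<psi>'' = (W1 \<otimes>\<^sub>m W2 \<otimes>\<^sub>m W3) *v \<psi>'"
    using assms(2) by (auto simp: LU_equivalent_def)
  have "\<psi>'' = ((W1 ** V1) \<otimes>\<^sub>m (W2 ** V2) \<otimes>\<^sub>m (W3 ** V3)) *v \<psi>"
    by (simp add: V(4) W(4) matrix_vector_mul_assoc tensor_mat_mult)
  then show ?thesis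
    unfolding LU_equivalent_def
    by (intro exI[of _ "W1 ** V1"] exI[of _ "W2 ** V2"] exI[of _ "W3 ** V3"] conjI unitary_mult V W)
qed

text \<open>On 00 and on 11 alike the two qubits contribute the factors \<open>z\<close> and
  \<open>cnj z\<close>, which cancel.\<close>

lemma phase_mats_schmidt_state:
  assumes "cmod z = 1"
  shows "(phase_mat z \<otimes>\<^sub>m phase_mat (cnj z)) *v schmidt_state a b = schmidt_state a b"
proof -
  have "z * cnj z = 1" using assms by (rule cmod_1_mult_cnj)
  then show ?thesis
    by (simp add: vec_eq_iff all_qubit phase_mat_def matrix_vector_mult_def sum_pairs sum_qubit
        schmidt_state_def mult.commute)
qed

text \<open>Both qubits agree in every term of the Schmidt state, so a diagonal matrix acts the same
  way on either of them.\<close>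

lemma phase_mat_transfer_schmidt_state:
  "(A \<otimes>\<^sub>m (B ** phase_mat z)) *v schmidt_state a b = ((A ** phase_mat z) \<otimes>\<^sub>m B) *v schmidt_state a b"
  by (simp add: vec_eq_iff all_qubit phase_mat_def matrix_vector_mult_def matrix_matrix_mult_def
      sum_pairs sum_qubit schmidt_state_def)

lemma phase_mat_mult: "phase_mat x ** phase_mat y = phase_mat (x * y)"
  by (simp add: phase_mat_def mat2_mult)

lemma mat_scale_mult: "mat_scale c A ** mat_scale d B = mat_scale (c * d) (A ** B)"
  by (simp add: vec_eq_iff matrix_matrix_mult_def sum_distrib_left mult_ac)

lemma mat_scale_one [simp]: "mat_scale 1 A = A"
  by (simp add: vec_eq_iff)

lemma tensor_mat_scale: "mat_scale c A \<otimes>\<^sub>m mat_scale d B = mat_scale (c * d) (A \<otimes>\<^sub>m B)"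
  by (simp add: vec_eq_iff)

lemma mat_scale_vec: "mat_scale c A *v x = c *s (A *v x)"
  by (simp add: vec_eq_iff matrix_vector_mult_def sum_distrib_left mult_ac)

text \<open>The relative phase \<open>w\<close> of the components is a diagonal unitary on qubit 1,
  so phases of the second component can be removed locally.\<close>

lemma LU_equivalent_scaled_kets:
  assumes "unitary_mat V" "unitary_mat W" "cmod w = 1"
  shows "LU_equivalent (c *\<^sub>R (ket0 \<otimes>\<^sub>v A + ket1 \<otimes>\<^sub>v B))
    (c *\<^sub>R (ket0 \<otimes>\<^sub>v ((V \<otimes>\<^sub>m W) *v A) + ket1 \<otimes>\<^sub>v (w *s ((V \<otimes>\<^sub>m W) *v B))))"
proof -
  have "unitary_mat (mat2 1 0 0 w)"
    using cmod_1_mult_cnj[OF assms(3)] by (intro unitary_mat2) simp_all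
  moreover have "(mat2 1 0 0 w \<otimes>\<^sub>m V \<otimes>\<^sub>m W) *v (c *\<^sub>R (ket0 \<otimes>\<^sub>v A + ket1 \<otimes>\<^sub>v B))
      = c *\<^sub>R ((mat2 1 0 0 w \<otimes>\<^sub>m V \<otimes>\<^sub>m W) *v (ket0 \<otimes>\<^sub>v A + ket1 \<otimes>\<^sub>v B))"
    by (simp add: vec_eq_iff matrix_vector_mult_def scaleR_right.sum)
  moreover have "(V \<otimes>\<^sub>m W) *v (w *s B) = w *s ((V \<otimes>\<^sub>m W) *v B)"
    by (simp add: vec_eq_iff matrix_vector_mult_def sum_distrib_left mult_ac)
  ultimately show ?thesis
    using assms unfolding LU_equivalent_def
    by (intro exI[of _ "mat2 1 0 0 w"] exI[of _ V] exI[of _ W]) (simp add: tensor_mat_kets)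
qed

text \<open>The Schmidt state absorbs the two diagonal factors of the Euler decomposition of the third
  unitary: the inner one moves to the second qubit and the outer one is undone by a local unitary
  that fixes the Schmidt state.\<close>

lemma LU_equivalent_canonical:
  assumes "unitary_mat R" "unitary_mat S"
  obtains \<alpha> \<beta> \<gamma> \<beta>' where "\<alpha> \<in> {- pi / 2 <.. pi / 2}" "\<gamma> \<in> {- pi / 2 <.. pi / 2}"
    "\<beta> \<in> {0 .. pi / 2}" "\<beta>' \<in> {0 .. pi / 2}"
    "LU_equivalent (c *\<^sub>R (ket0 \<otimes>\<^sub>v schmidt_state a b + ket1 \<otimes>\<^sub>v ((R \<otimes>\<^sub>m S) *v schmidt_state a b)))
      (c *\<^sub>R (ket0 \<otimes>\<^sub>v schmidt_state a b +
        ket1 \<otimes>\<^sub>v (((Zrot \<alpha> ** Yrot \<beta> ** Zrot \<gamma>) \<otimes>\<^sub>m Yrot \<beta>') *v schmidt_state a b)))"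
proof -
  let ?\<psi> = "schmidt_state a b"
  obtain w z1 z2 \<beta> where R: "cmod w = 1" "cmod z1 = 1" "cmod z2 = 1" "\<beta> \<in> {0..pi / 2}"
      "R = mat_scale w (phase_mat z1 ** Yrot \<beta> ** phase_mat z2)"
    using unitary_euler[OF assms(1)] by blast
  obtain w' y1 y2 \<beta>' where S: "cmod w' = 1" "cmod y1 = 1" "cmod y2 = 1" "\<beta>' \<in> {0..pi / 2}"
      "S = mat_scale w' (phase_mat y1 ** Yrot \<beta>' ** phase_mat y2)"
    using unitary_euler[OF assms(2)] by blast
  \<comment> \<open>The phases \<open>y1\<close> and \<open>y2\<close> of the third unitary will
    join \<open>z1\<close> and \<open>z2\<close> on the second qubit.\<close>
  have "cmod (y1 * z1) = 1" "cmod (z2 * y2) = 1" using R S by (simp_all add: norm_mult)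
  then obtain \<alpha> s \<gamma> t :: real where \<alpha>: "\<alpha> \<in> {- pi / 2 <.. pi / 2}" "s\<^sup>2 = 1" "phase_mat (y1 * z1) = mat_scale s (Zrot \<alpha>)"
    and \<gamma>: "\<gamma> \<in> {- pi / 2 <.. pi / 2}" "t\<^sup>2 = 1" "phase_mat (z2 * y2) = mat_scale t (Zrot \<gamma>)"
    by (metis phase_mat_Zrot)
  define U where "U = (Zrot \<alpha> ** Yrot \<beta> ** Zrot \<gamma>) \<otimes>\<^sub>m Yrot \<beta>'"
  \<comment> \<open>All leftover scalars: the two global phases and the signs from reducing the
    angles. Qubit 1 absorbs \<open>k\<close> through the factor \<open>cnj k\<close>.\<close>
  define k where "k = w * w' * of_real (s * t)"
  have "\<bar>s\<bar> = 1" "\<bar>t\<bar> = 1" using \<alpha>(2) \<gamma>(2) by (auto simp: power2_eq_1_iff)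
  then have k: "cmod k = 1" using R S by (simp add: k_def norm_mult)
  have "y1 * cnj y1 = 1" using S(2) by (rule cmod_1_mult_cnj)
  then have cancel: "phase_mat (cnj y1) ** phase_mat y1 = mat 1"
    unfolding phase_mat_mult by (simp add: phase_mat_def mat2_one mult.commute)
  have "(phase_mat y1 \<otimes>\<^sub>m phase_mat (cnj y1)) *v ((R \<otimes>\<^sub>m S) *v ?\<psi>)
    = (w * w') *s ((phase_mat y1 \<otimes>\<^sub>m phase_mat (cnj y1)) *v
        (((phase_mat z1 ** Yrot \<beta> ** phase_mat z2) \<otimes>\<^sub>m (phase_mat y1 ** Yrot \<beta>' ** phase_mat y2)) *v ?\<psi>))"
    unfolding R(5) S(5) tensor_mat_scale mat_scale_vec
    by (simp add: vec_eq_iff matrix_vector_mult_def sum_distrib_left mult_ac)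
  also have "\<dots> = (w * w') *s (((phase_mat y1 ** (phase_mat z1 ** Yrot \<beta> ** phase_mat z2 ** phase_mat y2)) \<otimes>\<^sub>m
        (phase_mat (cnj y1) ** (phase_mat y1 ** Yrot \<beta>'))) *v ?\<psi>)"
    unfolding phase_mat_transfer_schmidt_state by (simp only: matrix_vector_mul_assoc tensor_mat_mult)
  also have "phase_mat y1 ** (phase_mat z1 ** Yrot \<beta> ** phase_mat z2 ** phase_mat y2)
      = phase_mat (y1 * z1) ** Yrot \<beta> ** phase_mat (z2 * y2)"
    by (simp only: phase_mat_mult[symmetric] matrix_mul_assoc)
  also have "\<dots> = mat_scale s (Zrot \<alpha>) ** mat_scale 1 (Yrot \<beta>) ** mat_scale t (Zrot \<gamma>)"
    unfolding \<alpha>(3) \<gamma>(3) by simp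
  also have "\<dots> = mat_scale (s * t) (Zrot \<alpha> ** Yrot \<beta> ** Zrot \<gamma>)"
    unfolding mat_scale_mult by simp
  also have "phase_mat (cnj y1) ** (phase_mat y1 ** Yrot \<beta>') = mat_scale 1 (Yrot \<beta>')"
    unfolding matrix_mul_assoc cancel by simp
  also have "(w * w') *s ((mat_scale (s * t) (Zrot \<alpha> ** Yrot \<beta> ** Zrot \<gamma>) \<otimes>\<^sub>m mat_scale 1 (Yrot \<beta>')) *v ?\<psi>)
      = k *s (U *v ?\<psi>)"
    unfolding tensor_mat_scale mat_scale_vec U_def k_def by (simp add: vec_eq_iff mult_ac)
  finally have eq: "(phase_mat y1 \<otimes>\<^sub>m phase_mat (cnj y1)) *v ((R \<otimes>\<^sub>m S) *v ?\<psi>) = k *s (U *v ?\<psi>)" .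
  have "cnj k *s (k *s (U *v ?\<psi>)) = U *v ?\<psi>"
    using cmod_1_mult_cnj[OF k] by (simp add: vec_eq_iff mult.assoc[symmetric] mult.commute)
  moreover have "unitary_mat (phase_mat y1)" "unitary_mat (phase_mat (cnj y1))"
    using S(2) by (simp_all add: unitary_phase_mat)
  ultimately have "LU_equivalent (c *\<^sub>R (ket0 \<otimes>\<^sub>v ?\<psi> + ket1 \<otimes>\<^sub>v ((R \<otimes>\<^sub>m S) *v ?\<psi>)))
      (c *\<^sub>R (ket0 \<otimes>\<^sub>v ?\<psi> + ket1 \<otimes>\<^sub>v (U *v ?\<psi>)))"
    using LU_equivalent_scaled_kets[of "phase_mat y1" "phase_mat (cnj y1)" "cnj k" c ?\<psi> "(R \<otimes>\<^sub>m S) *v ?\<psi>"] k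
    unfolding eq phase_mats_schmidt_state[OF S(2)] by simp
  then show ?thesis
    using that \<alpha>(1) \<gamma>(1) R(4) S(4) unfolding U_def by blast
qed

theorem mainTheorem1:
  fixes \<psi> :: qubits3
  assumes "norm \<psi> = 1"
    and "truly_tripartite_entangled \<psi>"
  shows "\<exists>(a::real) (b::real) (\<alpha>::real) (\<beta>::real) (\<gamma>::real) (\<beta>'::real).
    a \<ge> b \<and> b \<ge> 0 \<and> a\<^sup>2 + b\<^sup>2 = 1 \<and>
    \<alpha> \<in> {- pi / 2 <.. pi / 2} \<and> \<gamma> \<in> {- pi / 2 <.. pi / 2} \<and>
    \<beta> \<in> {0 .. pi / 2} \<and> \<beta>' \<in> {0 .. pi / 2} \<and>
    (let \<psi>\<^sub>s = schmidt_state a b;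
         U2 = Zrot \<alpha> ** Yrot \<beta> ** Zrot \<gamma>;
         U3 = Yrot \<beta>'
     in LU_equivalent \<psi>
          ((1 / sqrt 2) *\<^sub>R (ket0 \<otimes>\<^sub>v \<psi>\<^sub>s + ket1 \<otimes>\<^sub>v ((U2 \<otimes>\<^sub>m U3) *v \<psi>\<^sub>s))) \<and>
        ent_of_conc (mixed_concurrence (reduced23 \<psi>)) \<le> entanglement \<psi>\<^sub>s \<and>
        entanglement \<psi>\<^sub>s \<le> ent_of_conc (concurrence_of_assistance (reduced23 \<psi>)))"
proof -
  obtain A B :: qubits2 where \<psi>: "\<psi> = ket0 \<otimes>\<^sub>v A + ket1 \<otimes>\<^sub>v B"
    using ket_decomp by blast
  obtain V :: "complex^2^2" where V: "unitary_mat V"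
    "norm (V $ 0 $ 0 *s A + V $ 0 $ 1 *s B) = norm (V $ 1 $ 0 *s A + V $ 1 $ 1 *s B)"
    "concurrence (V $ 0 $ 0 *s A + V $ 0 $ 1 *s B) = concurrence (V $ 1 $ 0 *s A + V $ 1 $ 1 *s B)"
    by (rule balancing_unitary)
  \<comment> \<open>The factor \<open>sqrt 2\<close> turns the balanced components into unit
    vectors.\<close>
  define \<phi> where "\<phi> i = sqrt 2 *\<^sub>R (V $ i $ 0 *s A + V $ i $ 1 *s B)" for i
  have \<phi>_inv: "V $ i $ 0 *s A + V $ i $ 1 *s B = (1 / sqrt 2) *\<^sub>R \<phi> i" for i
    by (simp add: \<phi>_def)
  have same: "norm (\<phi> 0) = norm (\<phi> 1)" "concurrence (\<phi> 0) = concurrence (\<phi> 1)"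
  proof -
    have "concurrence (c *\<^sub>R x) = c\<^sup>2 * concurrence x" for c x
    proof -
      have "c *\<^sub>R x = complex_of_real c *s x" by (simp add: vec_eq_iff) (simp add: scaleR_conv_of_real)
      then show ?thesis by (simp add: concurrence_amp_det amp_det_scale norm_mult norm_power)
    qed
    then show "norm (\<phi> 0) = norm (\<phi> 1)" "concurrence (\<phi> 0) = concurrence (\<phi> 1)"
      using V by (simp_all add: \<phi>_def)
  qed
  define \<psi>' where "\<psi>' = (1 / sqrt 2) *\<^sub>R (ket0 \<otimes>\<^sub>v \<phi> 0 + ket1 \<otimes>\<^sub>v \<phi> 1)"
  have V\<psi>: "(V \<otimes>\<^sub>m mat 1 \<otimes>\<^sub>m mat 1) *v \<psi> = \<psi>'"
    unfolding \<psi> tensor_mat_one tensor_mat_kets \<phi>_inv \<psi>'_def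
    by (simp add: vec_eq_iff all_qubit)
  then have LU1: "LU_equivalent \<psi> \<psi>'"
    unfolding LU_equivalent_def
    by (intro exI[of _ V] exI[of _ "mat 1"] conjI V(1) unitary_one) simp
  have "unitary_mat (V \<otimes>\<^sub>m mat 1 \<otimes>\<^sub>m mat 1 :: complex^(2\<times>2\<times>2)^(2\<times>2\<times>2))"
    by (intro unitary_tensor V(1) unitary_one)
  from norm_unitary[OF this, of \<psi>] have "norm \<psi>' = 1" by (simp only: V\<psi> assms(1))
  then have "norm (ket0 \<otimes>\<^sub>v \<phi> 0 + ket1 \<otimes>\<^sub>v \<phi> 1) = sqrt 2"
    unfolding \<psi>'_def norm_scaleR by (simp add: field_simps)
  then have "(norm (\<phi> 0))\<^sup>2 + (norm (\<phi> 1))\<^sup>2 = 2"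
    by (simp flip: norm_kets)
  then have "(norm (\<phi> 0))\<^sup>2 = 1" "(norm (\<phi> 1))\<^sup>2 = 1" using same by simp_all
  then have nrm: "norm (\<phi> 0) = 1" "norm (\<phi> 1) = 1"
    by (simp_all add: power2_eq_1_iff) (smt (verit) norm_ge_zero)+
  obtain P Q a b where 0: "unitary_mat P" "unitary_mat Q" "a \<ge> b" "b \<ge> 0"
      "(P \<otimes>\<^sub>m Q) *v \<phi> 0 = schmidt_state a b"
    by (rule schmidt_decomposition)
  obtain P' Q' a' b' where 1: "unitary_mat P'" "unitary_mat Q'" "a' \<ge> b'" "b' \<ge> 0"
      "(P' \<otimes>\<^sub>m Q') *v \<phi> 1 = schmidt_state a' b'"
    by (rule schmidt_decomposition)
  \<comment> \<open>Norm and concurrence are invariant under local unitaries, so they can be read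
    off from either vector; equal values then force equal Schmidt coefficients.\<close>
  have inv: "x\<^sup>2 + y\<^sup>2 = 1" "2 * (x * y) = concurrence v"
    if "unitary_mat M" "unitary_mat N" "x \<ge> y" "y \<ge> 0" "(M \<otimes>\<^sub>m N) *v v = schmidt_state x y" "norm v = 1"
    for M N x y v
  proof -
    show "x\<^sup>2 + y\<^sup>2 = 1"
      using norm_unitary[OF unitary_tensor[OF that(1,2)], of v] that(5,6)
      by (simp flip: norm_schmidt_state)
    show "2 * (x * y) = concurrence v"
      using concurrence_tensor_unitary[OF that(1,2), of v] that(3-5)
      by (simp add: concurrence_schmidt_state)
  qed
  note i0 = inv[OF 0 nrm(1)] and i1 = inv[OF 1 nrm(2)]
  have "a' = a \<and> b' = b"
    using i0 i1 same 0 1 by (intro schmidt_coefficients_unique) auto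
  then have schmidt1: "(P' \<otimes>\<^sub>m Q') *v \<phi> 1 = schmidt_state a b" using 1(5) by simp
  \<comment> \<open>\<open>P\<close> and \<open>Q\<close> bring the first component to Schmidt form;
    \<open>R\<close> and \<open>S\<close> are what separates the image of the second one from the
    same Schmidt state.\<close>
  define R where "R = P ** adjoint_mat P'"
  define S where "S = Q ** adjoint_mat Q'"
  have RS: "unitary_mat R" "unitary_mat S"
    unfolding R_def S_def by (intro unitary_mult unitary_adjoint 0 1)+
  have "(R \<otimes>\<^sub>m S) *v schmidt_state a b
      = ((P ** (adjoint_mat P' ** P')) \<otimes>\<^sub>m (Q ** (adjoint_mat Q' ** Q'))) *v \<phi> 1"
    unfolding schmidt1[symmetric] R_def S_def matrix_vector_mul_assoc tensor_mat_mult matrix_mul_assoc ..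
  then have PQ1: "(P \<otimes>\<^sub>m Q) *v \<phi> 1 = (R \<otimes>\<^sub>m S) *v schmidt_state a b"
    using 1 by (simp add: unitary_mat_def)
  have LU2: "LU_equivalent \<psi>' ((1 / sqrt 2) *\<^sub>R (ket0 \<otimes>\<^sub>v schmidt_state a b + ket1 \<otimes>\<^sub>v ((R \<otimes>\<^sub>m S) *v schmidt_state a b)))"
    using LU_equivalent_scaled_kets[OF 0(1,2), of 1 "1 / sqrt 2" "\<phi> 0" "\<phi> 1"]
    unfolding 0(5) PQ1 \<psi>'_def by simp
  obtain \<alpha> \<beta> \<gamma> \<beta>' where ang: "\<alpha> \<in> {- pi / 2 <.. pi / 2}" "\<gamma> \<in> {- pi / 2 <.. pi / 2}"
    "\<beta> \<in> {0 .. pi / 2}" "\<beta>' \<in> {0 .. pi / 2}"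
    and LU3: "LU_equivalent ((1 / sqrt 2) *\<^sub>R (ket0 \<otimes>\<^sub>v schmidt_state a b + ket1 \<otimes>\<^sub>v ((R \<otimes>\<^sub>m S) *v schmidt_state a b)))
      ((1 / sqrt 2) *\<^sub>R (ket0 \<otimes>\<^sub>v schmidt_state a b +
        ket1 \<otimes>\<^sub>v (((Zrot \<alpha> ** Yrot \<beta> ** Zrot \<gamma>) \<otimes>\<^sub>m Yrot \<beta>') *v schmidt_state a b)))"
    by (rule LU_equivalent_canonical[OF RS])
  have LU: "LU_equivalent \<psi> ((1 / sqrt 2) *\<^sub>R (ket0 \<otimes>\<^sub>v schmidt_state a b +
        ket1 \<otimes>\<^sub>v (((Zrot \<alpha> ** Yrot \<beta> ** Zrot \<gamma>) \<otimes>\<^sub>m Yrot \<beta>') *v schmidt_state a b)))"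
    by (rule LU_equivalent_trans[OF LU_equivalent_trans[OF LU1 LU2] LU3])
  have "projector ((1 / sqrt 2) *\<^sub>R v) = (1 / 2) *\<^sub>R projector v" for v :: qubits2
    by (simp add: vec_eq_iff projector_def)
  then have \<rho>: "reduced23 \<psi> = (1 / 2) *\<^sub>R projector (\<phi> 0) + (1 / 2) *\<^sub>R projector (\<phi> 1)"
    unfolding \<psi> reduced23_kets unitary_row_mix_projector[OF V(1), of A B, symmetric] \<phi>_inv by simp
  \<comment> \<open>The ensemble consists of the two components with weight 1/2 each; both have
    concurrence \<open>2 * (a * b)\<close>, hence so does their average.\<close>
  have "2 * (a * b) \<in> ensemble_concurrences (reduced23 \<psi>)"
    unfolding ensemble_concurrences_def mem_Collect_eq pure_ensemble_def \<rho>
    by (intro exI[of _ "2::nat"] exI[of _ "\<lambda>_. 1 / 2"] exI[of _ "\<lambda>j. if j = 0 then \<phi> 0 else \<phi> 1"])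
      (simp add: numeral_2_eq_2 nrm i0(2) same(2))
  note bounds = extremal_concurrence_bounds[OF this]
  have "entanglement (schmidt_state a b) = ent_of_conc (2 * (a * b))"
    using 0(3,4) i0(1) by (rule entanglement_schmidt_state_conc)
  then have ent: "ent_of_conc (mixed_concurrence (reduced23 \<psi>)) \<le> entanglement (schmidt_state a b)"
      "entanglement (schmidt_state a b) \<le> ent_of_conc (concurrence_of_assistance (reduced23 \<psi>))"
    using bounds by (auto intro!: ent_of_conc_mono)
  show ?thesis
    unfolding Let_def by (intro exI conjI) (fact 0(3,4) i0(1) ang LU ent)+
qed

end
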